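(* Let $d$ be a degree sequence and let $\mathcal{F}(d)$ be the subgraph of the realization graph $\mathcal{G}(d)$ induced by the forests with degree sequence $d$. Then $\mathcal{F}(d)$ is connected. Equivalently, for any two forests $F,F'$ on the vertex set $\{1,\dots,n\}$ with the same degree sequence, there is a finite sequence of 2-switches transforming $F$ into $F'$ such that every intermediate graph is a forest.
   Context: All graphs are finite and simple. For a graph $G$ with $V(G)=\{1,\dots,n\}$, its degree sequence is $d(G)=(d_1,\dots,d_n)$ where $d_v$ is the degree of $v$. A 2-switch on $G$ is specified by four distinct vertices $a,b,c,d$ with $ab,cd\in E(G)$ and $ac,bd\notin E(G)$; it produces $G-ab-cd+ac+bd$ (same degree sequence). The realization graph $\mathcal{G}(d)$ has as vertices all graphs on $\{1,\dots,n\}$ with degree sequence $d$, two graphs being adjacent if one is obtained from the other by a single 2-switch. *)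

theory Defs
  imports Main
begin

type_synonym 'a graph = "'a set \<times> 'a set set"

abbreviation verts :: "'a graph \<Rightarrow> 'a set" where
  "verts G \<equiv> fst G"

abbreviation edges :: "'a graph \<Rightarrow> 'a set set" where
  "edges G \<equiv> snd G"

definition simple_graph :: "'a graph \<Rightarrow> bool" where
  "simple_graph G \<longleftrightarrow>
     finite (verts G) \<and> (\<forall>e\<in>edges G. \<exists>u\<in>verts G. \<exists>v\<in>verts G. u \<noteq> v \<and> e = {u, v})"

definition adjacent :: "'a graph \<Rightarrow> 'a \<Rightarrow> 'a \<Rightarrow> bool" where
  "adjacent G u v \<longleftrightarrow> {u, v} \<in> edges G"

definition induced_subgraph :: "'a graph \<Rightarrow> 'a set \<Rightarrow> 'a graph" where
  "induced_subgraph G W = (verts G \<inter> W, {e \<in> edges G. e \<subseteq> W})"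

definition is_walk :: "'a graph \<Rightarrow> 'a list \<Rightarrow> bool" where
  "is_walk G p \<longleftrightarrow> p \<noteq> [] \<and> set p \<subseteq> verts G \<and> successively (adjacent G) p"

text \<open>The graph without vertices counts as connected; this matters for degree sequences
  that are not realized by any forest.\<close>

definition connected_graph :: "'a graph \<Rightarrow> bool" where
  "connected_graph G \<longleftrightarrow>
     (\<forall>u\<in>verts G. \<forall>v\<in>verts G. \<exists>p. is_walk G p \<and> hd p = u \<and> last p = v)"

definition is_cycle :: "'a graph \<Rightarrow> 'a list \<Rightarrow> bool" where
  "is_cycle G p \<longleftrightarrow>
     is_walk G p \<and> length p \<ge> 3 \<and> distinct p \<and> adjacent G (last p) (hd p)"

definition forest :: "'a graph \<Rightarrow> bool" where
  "forest G \<longleftrightarrow> simple_graph G \<and> (\<nexists>p. is_cycle G p)"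

definition degree :: "'a graph \<Rightarrow> 'a \<Rightarrow> nat" where
  "degree G v = card {e \<in> edges G. v \<in> e}"

definition graph_on :: "nat \<Rightarrow> nat graph \<Rightarrow> bool" where
  "graph_on n G \<longleftrightarrow> simple_graph G \<and> verts G = {1..n}"

text \<open>The entry of vertex \<open>v\<close> of a graph on \<open>{1..n}\<close> has list index \<open>v - 1\<close>.\<close>

definition degree_sequence :: "nat graph \<Rightarrow> nat list" where
  "degree_sequence G = map (degree G) [1..<Suc (card (verts G))]"

definition realizations :: "nat list \<Rightarrow> nat graph set" where
  "realizations d = {G. graph_on (length d) G \<and> degree_sequence G = d}"

definition is_degree_sequence :: "nat list \<Rightarrow> bool" where
  "is_degree_sequence d \<longleftrightarrow> (\<exists>n G. graph_on n G \<and> degree_sequence G = d)"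

definition two_switch :: "'a graph \<Rightarrow> 'a graph \<Rightarrow> bool" where
  "two_switch G H \<longleftrightarrow>
     (\<exists>a b c d. distinct [a, b, c, d] \<and>
        {a, b} \<in> edges G \<and> {c, d} \<in> edges G \<and> {a, c} \<notin> edges G \<and> {b, d} \<notin> edges G \<and>
        H = (verts G, edges G - {{a, b}, {c, d}} \<union> {{a, c}, {b, d}}))"

definition realization_graph :: "nat list \<Rightarrow> nat graph graph" where
  "realization_graph d =
     (realizations d,
      {{G, H} | G H. G \<in> realizations d \<and> H \<in> realizations d \<and> two_switch G H})"

definition forest_realization_graph :: "nat list \<Rightarrow> nat graph graph" where
  "forest_realization_graph d =
     induced_subgraph (realization_graph d) {F \<in> realizations d. forest F}"

lemma two_switch_neq:
  assumes "two_switch G H"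
  shows "G \<noteq> H"
proof -
  obtain a b c d where "{a, c} \<notin> edges G"
    and "H = (verts G, edges G - {{a, b}, {c, d}} \<union> {{a, c}, {b, d}})"
    using assms unfolding two_switch_def by blast
  then have "{a, c} \<in> edges H" by simp
  with \<open>{a, c} \<notin> edges G\<close> show ?thesis by metis
qed

lemma finite_realizations: "finite (realizations d)"
proof (rule finite_subset)
  show "realizations d \<subseteq> {{1..length d}} \<times> Pow (Pow {1..length d})"
  proof
    fix G assume "G \<in> realizations d"
    then have G: "simple_graph G" "verts G = {1..length d}"
      by (simp_all add: realizations_def graph_on_def)
    have "edges G \<subseteq> Pow {1..length d}"
    proof
      fix e assume "e \<in> edges G"
      then obtain u v where "u \<in> verts G" "v \<in> verts G" "e = {u, v}"
        using G(1) unfolding simple_graph_def by meson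
      then show "e \<in> Pow {1..length d}" using G(2) by simp
    qed
    with G show "G \<in> {{1..length d}} \<times> Pow (Pow {1..length d})"
      by (simp add: mem_Times_iff)
  qed
qed simp

lemma simple_graph_realization_graph: "simple_graph (realization_graph d)"
proof -
  have "\<exists>G\<in>realizations d. \<exists>H\<in>realizations d. G \<noteq> H \<and> e = {G, H}"
    if e: "e \<in> edges (realization_graph d)" for e
  proof -
    obtain G H where "G \<in> realizations d" "H \<in> realizations d" "two_switch G H" "e = {G, H}"
      using e unfolding realization_graph_def snd_conv mem_Collect_eq by metis
    then show ?thesis using two_switch_neq by metis
  qed
  then show ?thesis
    by (simp add: simple_graph_def finite_realizations realization_graph_def)
qed

end

theory Submission
  imports Defs
begin

text \<open>Induction on the number of edges. Let \<open>v\<close> be a leaf, attached to \<open>u\<close> in \<open>F\<close> and to \<open>u'\<close> in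
  \<open>F'\<close>. If \<open>u = u'\<close>, the edge at \<open>v\<close> is deleted from both forests; a switch of the smaller
  forests never touches the now isolated vertex \<open>v\<close>, so it lifts. If \<open>u \<noteq> u'\<close> and \<open>u'\<close> has degree at least 2,
  then \<open>u'\<close> has a neighbour \<open>w\<close> in \<open>F\<close> that does not lie on the path from \<open>u'\<close> to \<open>u\<close>, and replacing
  \<open>vu\<close>, \<open>u'w\<close> by \<open>vu'\<close>, \<open>uw\<close> keeps \<open>F\<close> a forest and attaches \<open>v\<close> to \<open>u'\<close>. If \<open>u'\<close> has degree 1,
  then \<open>vu'\<close> is a component of \<open>F'\<close>, and replacing \<open>vu'\<close>, \<open>uw\<close> by \<open>vu\<close>, \<open>u'w\<close> in \<open>F'\<close>, for any
  neighbour \<open>w\<close> of \<open>u\<close>, attaches \<open>v\<close> to \<open>u\<close> in \<open>F'\<close>.\<close>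

section \<open>Reachability and acyclic edge sets\<close>

text \<open>Connectivity depends on the edge set alone, so edges can be deleted and inserted without
  carrying a vertex set along. Every element of the type reaches itself.\<close>

definition reach :: "'a set set \<Rightarrow> 'a \<Rightarrow> 'a \<Rightarrow> bool" where
  "reach E = (\<lambda>x y. {x, y} \<in> E)\<^sup>*\<^sup>*"

lemma reach_refl [simp]: "reach E x x"
  by (simp add: reach_def)

lemma reach_edge: "{x, y} \<in> E \<Longrightarrow> reach E x y"
  by (auto simp: reach_def)

lemma reach_trans: "reach E x y \<Longrightarrow> reach E y z \<Longrightarrow> reach E x z"
  by (auto simp: reach_def)

lemma reach_sym: "reach E x y \<Longrightarrow> reach E y x"
  unfolding reach_def
  by (rule sympD[OF symp_rtranclp]) (auto intro: sympI simp: insert_commute)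

lemma reach_mono: "reach E x y \<Longrightarrow> E \<subseteq> E' \<Longrightarrow> reach E' x y"
  unfolding reach_def by (erule rtranclp_mono[THEN predicate2D, rotated]) auto

text \<open>A walk that uses the new edge can be shortened so that it crosses this edge exactly
  once, in one of the two directions.\<close>

lemma reach_insertD:
  assumes "reach (insert {x, y} E) a b"
  shows "reach E a b \<or> (reach E a x \<and> reach E y b) \<or> (reach E a y \<and> reach E x b)"
  using assms[unfolded reach_def]
proof (induction rule: rtranclp_induct)
  case base
  show ?case by simp
next
  case (step b c)
  then consider "{b, c} \<in> E" | "b = x" "c = y" | "b = y" "c = x"
    by (auto simp: doubleton_eq_iff)
  then show ?case
  proof cases
    case 1
    then show ?thesis using step.IH reach_trans[OF _ reach_edge] by metis
  next
    case 2
    then show ?thesis using step.IH by auto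
  next
    case 3
    then show ?thesis using step.IH by auto
  qed
qed

lemma reach_isolated:
  assumes "reach E x y" "\<forall>e\<in>E. x \<notin> e"
  shows "x = y"
  using assms(1)[unfolded reach_def] assms(2) by (cases rule: converse_rtranclpE) auto

text \<open>Every edge is a bridge. The instance \<open>x = y\<close> rules out singleton edges,
  because \<open>reach\<close> is reflexive.\<close>

definition acyclic_edges :: "'a set set \<Rightarrow> bool" where
  "acyclic_edges E \<longleftrightarrow> (\<forall>x y. {x, y} \<in> E \<longrightarrow> \<not> reach (E - {{x, y}}) x y)"

lemma acyclic_edgesD:
  "acyclic_edges E \<Longrightarrow> {x, y} \<in> E \<Longrightarrow> \<not> reach (E - {{x, y}}) x y"
  by (simp add: acyclic_edges_def)

lemma acyclic_edges_neq: "acyclic_edges E \<Longrightarrow> {x, y} \<in> E \<Longrightarrow> x \<noteq> y"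
  using acyclic_edgesD reach_refl by metis

lemma acyclic_edges_subset: "acyclic_edges E \<Longrightarrow> E' \<subseteq> E \<Longrightarrow> acyclic_edges E'"
  unfolding acyclic_edges_def by (meson Diff_mono order_refl reach_mono subsetD)

text \<open>If a detour around an old edge \<open>{a, b}\<close> crosses the new edge, then its two
  remaining pieces together with \<open>{a, b}\<close> join \<open>x\<close> to \<open>y\<close>
  inside \<open>E\<close>, which is excluded.\<close>

lemma acyclic_edges_insert:
  assumes E: "acyclic_edges E" and xy: "\<not> reach E x y"
  shows "acyclic_edges (insert {x, y} E)"
  unfolding acyclic_edges_def
proof (intro allI impI notI)
  fix a b
  assume ab: "{a, b} \<in> insert {x, y} E" and r: "reach (insert {x, y} E - {{a, b}}) a b"
  have yx: "\<not> reach E y x" using xy reach_sym by metis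
  show False
  proof (cases "{a, b} = {x, y}")
    case True
    then have "reach E a b" using r reach_mono[of _ a b E] by auto
    then show False using True xy yx by (auto simp: doubleton_eq_iff)
  next
    case False
    then have abE: "{a, b} \<in> E" using ab by auto
    have "reach (insert {x, y} (E - {{a, b}})) a b"
      using r False by (simp add: insert_Diff_if split: if_splits)
    then consider "reach (E - {{a, b}}) a b" | "reach E a x" "reach E y b"
      | "reach E a y" "reach E x b"
      using reach_insertD reach_mono[of "E - {{a, b}}" _ _ E] by (metis Diff_subset)
    then show False
    proof cases
      case 1
      then show False using acyclic_edgesD[OF E abE] by blast
    next
      case 2
      then show False using xy reach_edge[OF abE] reach_sym reach_trans by metis
    next
      case 3
      then show False using xy reach_edge[OF abE] reach_sym reach_trans by metis
    qed
  qed
qed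

text \<open>At most one neighbour of \<open>c\<close> lies on a path from \<open>c\<close> to \<open>u\<close>.\<close>

lemma acyclic_edges_neighbour_away:
  assumes E: "acyclic_edges E" and w: "{c, w} \<in> E" "{c, w'} \<in> E" "w \<noteq> w'"
  shows "\<not> reach (E - {{c, w}}) u w \<or> \<not> reach (E - {{c, w'}}) u w'"
proof (rule ccontr)
  define D where "D = E - {{c, w}, {c, w'}}"
  assume "\<not> ?thesis"
  moreover have D1: "E - {{c, w}} = insert {c, w'} D" and D2: "E - {{c, w'}} = insert {c, w} D"
    using w by (auto simp: D_def doubleton_eq_iff)
  ultimately have r: "reach (insert {c, w'} D) u w" "reach (insert {c, w} D) u w'"
    by auto
  have n1: "\<not> reach (insert {c, w'} D) c w" and n2: "\<not> reach (insert {c, w} D) c w'"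
    using acyclic_edgesD[OF E w(1)] acyclic_edgesD[OF E w(2)] D1 D2 by auto
  have n: "\<not> reach D c w" "\<not> reach D c w'"
    using n1 n2 reach_mono[of D] by (meson subset_insertI)+
  have nw: "\<not> reach D w w'"
  proof
    assume "reach D w w'"
    then have "reach (insert {c, w} D) w w'" by (rule reach_mono) auto
    then show False using n2 reach_trans[OF reach_edge] by (metis insertI1)
  qed
  \<comment> \<open>Neither walk can use its extra edge at \<open>c\<close>: after crossing
    \<open>{c, w'}\<close> it would have to reach \<open>w\<close> in \<open>D\<close> from
    \<open>c\<close> or from \<open>w'\<close>, and symmetrically for the other walk.\<close>
  have "reach D u w" "reach D u w'"
    using reach_insertD[OF r(1)] reach_insertD[OF r(2)] n nw reach_sym by metis+
  then show False using nw reach_sym reach_trans by metis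
qed

section \<open>Forests as edge sets\<close>

text \<open>The form \<open>{x, y}\<close> alone would admit singletons; acyclicity excludes
  them.\<close>

definition forest_edges :: "'a set set \<Rightarrow> bool" where
  "forest_edges E \<longleftrightarrow> finite E \<and> (\<forall>e\<in>E. \<exists>x y. e = {x, y}) \<and> acyclic_edges E"

definition edge_degree :: "'a set set \<Rightarrow> 'a \<Rightarrow> nat" where
  "edge_degree E v = card {e \<in> E. v \<in> e}"

lemma forest_edges_incident:
  assumes "forest_edges E" "e \<in> E" "v \<in> e"
  obtains u where "e = {v, u}"
  using assms unfolding forest_edges_def by (metis insertE insert_commute singletonD)

lemma edge_degree_eq_0_iff: "finite E \<Longrightarrow> edge_degree E v = 0 \<longleftrightarrow> (\<forall>e\<in>E. v \<notin> e)"
  by (auto simp: edge_degree_def)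

lemma edge_degree_pos_neighbour:
  assumes "forest_edges E" "edge_degree E v > 0"
  obtains u where "{v, u} \<in> E"
proof -
  have "{e \<in> E. v \<in> e} \<noteq> {}" using assms(2) by (auto simp: edge_degree_def card_gt_0_iff)
  then show ?thesis using that forest_edges_incident[OF assms(1)] by blast
qed

lemma edge_degree_1_unique:
  assumes "edge_degree E v = 1" "{v, u} \<in> E" "e \<in> E" "v \<in> e"
  shows "e = {v, u}"
proof -
  obtain f where f: "{e \<in> E. v \<in> e} = {f}"
    using assms(1) unfolding edge_degree_def by (rule card_1_singletonE)
  have "e \<in> {f}" "{v, u} \<in> {f}"
    unfolding f[symmetric] using assms(2-4) by simp_all
  then show ?thesis by simp
qed

lemma edge_degree_not_1_neighbour:
  assumes "forest_edges E" "edge_degree E v \<noteq> 1" "{v, u} \<in> E"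
  obtains w where "{v, w} \<in> E" "w \<noteq> u"
proof -
  have "{e \<in> E. v \<in> e} \<noteq> {{v, u}}"
    using assms(2) unfolding edge_degree_def by (metis is_singletonI is_singleton_altdef)
  moreover have "{v, u} \<in> {e \<in> E. v \<in> e}" using assms(3) by simp
  ultimately obtain e where "e \<in> E" "v \<in> e" "e \<noteq> {v, u}" by blast
  then show ?thesis using that forest_edges_incident[OF assms(1)] by metis
qed

lemma edge_degree_insert:
  assumes "finite E" "{x, y} \<notin> E"
  shows "edge_degree (insert {x, y} E) v = edge_degree E v + (if v = x \<or> v = y then 1 else 0)"
proof -
  have "{e \<in> insert {x, y} E. v \<in> e} =
      (if v = x \<or> v = y then insert {x, y} {e \<in> E. v \<in> e} else {e \<in> E. v \<in> e})"
    by auto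
  then show ?thesis using assms by (simp add: edge_degree_def)
qed

section \<open>Building forests edge by edge, and the existence of leaves\<close>

lemma forest_edges_subset: "forest_edges E \<Longrightarrow> E' \<subseteq> E \<Longrightarrow> forest_edges E'"
  unfolding forest_edges_def by (meson acyclic_edges_subset finite_subset subsetD)

lemma forest_edges_insert:
  "forest_edges E \<Longrightarrow> \<not> reach E x y \<Longrightarrow> forest_edges (insert {x, y} E)"
  unfolding forest_edges_def using acyclic_edges_insert by auto

lemma forest_edges_insert_leaf:
  "forest_edges E \<Longrightarrow> \<forall>e\<in>E. x \<notin> e \<Longrightarrow> x \<noteq> y \<Longrightarrow> forest_edges (insert {x, y} E)"
  using forest_edges_insert reach_isolated by metis

text \<open>Cross from \<open>x\<close> to \<open>y\<close> and keep walking: a forest offers no way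
  back, so the walk ends at a leaf. Recording on which side of the edge the leaf lies is what makes
  the induction work.\<close>

lemma forest_edges_leaf_beyond_edge:
  assumes "forest_edges E" "{x, y} \<in> E"
  shows "\<exists>z. reach (E - {{x, y}}) y z \<and> edge_degree E z = 1"
  using assms
proof (induction "card E" arbitrary: E x y rule: less_induct)
  case less
  define D where "D = E - {{x, y}}"
  have fin: "finite E" and ac: "acyclic_edges E" using less.prems by (auto simp: forest_edges_def)
  have D: "forest_edges D" "finite D"
    using fin by (auto simp: D_def intro: forest_edges_subset[OF less.prems(1)])
  have E: "E = insert {x, y} D" "{x, y} \<notin> D" using less.prems(2) by (auto simp: D_def)
  show ?case
  proof (cases "edge_degree E y = 1")
    case True
    then show ?thesis using reach_refl by metis
  next
    case False
    then obtain t where t: "{y, t} \<in> E" "t \<noteq> x"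
      using edge_degree_not_1_neighbour[OF less.prems(1)] less.prems(2) by (metis insert_commute)
    then have tD: "{y, t} \<in> D" by (auto simp: D_def doubleton_eq_iff)
    have "card D < card E" using fin less.prems(2) unfolding D_def by (rule card_Diff1_less)
    then obtain z where z: "reach (D - {{y, t}}) t z" "edge_degree D z = 1"
      using less.hyps[OF _ D(1) tD] by blast
    have tz: "reach D t z" using z(1) by (rule reach_mono) auto
    have yz: "reach D y z" using reach_trans[OF reach_edge[OF tD] tz] .
    \<comment> \<open>Restoring \<open>{x, y}\<close> raises only the degrees of \<open>x\<close>
      and \<open>y\<close>. Since \<open>z\<close> lies beyond both deleted edges, it is neither of
      them and remains a leaf in \<open>E\<close>.\<close>
    have "z \<noteq> x"
      using yz acyclic_edgesD[OF ac less.prems(2)] reach_sym unfolding D_def by metis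
    moreover have "z \<noteq> y"
      using z(1) acyclic_edgesD[OF _ tD] D(1) reach_sym unfolding forest_edges_def by metis
    ultimately have "edge_degree E z = 1"
      using edge_degree_insert[OF D(2) E(2)] z(2) E(1) by simp
    then show ?thesis using yz D_def by blast
  qed
qed

lemma forest_edges_leaf:
  assumes "forest_edges E" "E \<noteq> {}"
  obtains v where "edge_degree E v = 1"
proof -
  obtain x y where "{x, y} \<in> E"
    using assms unfolding forest_edges_def by (metis all_not_in_conv)
  then show ?thesis using forest_edges_leaf_beyond_edge[OF assms(1)] that by blast
qed

section \<open>Switches between forests\<close>

definition edge_switch :: "'a set set \<Rightarrow> 'a set set \<Rightarrow> bool" where
  "edge_switch E H \<longleftrightarrow> (\<exists>a b c d. distinct [a, b, c, d] \<and>
     {a, b} \<in> E \<and> {c, d} \<in> E \<and> {a, c} \<notin> E \<and> {b, d} \<notin> E \<and>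
     H = E - {{a, b}, {c, d}} \<union> {{a, c}, {b, d}})"

text \<open>Exchanging the roles of \<open>b\<close> and \<open>c\<close> gives the inverse
  switch.\<close>

lemma edge_switch_sym:
  assumes "edge_switch E H"
  shows "edge_switch H E"
proof -
  obtain a b c d where d: "distinct [a, b, c, d]" and e: "{a, b} \<in> E" "{c, d} \<in> E"
    and n: "{a, c} \<notin> E" "{b, d} \<notin> E"
    and H: "H = E - {{a, b}, {c, d}} \<union> {{a, c}, {b, d}}"
    using assms unfolding edge_switch_def by blast
  have "distinct [a, c, b, d]" "{a, c} \<in> H" "{b, d} \<in> H" "{a, b} \<notin> H" "{c, d} \<notin> H"
    using d H by (auto simp: doubleton_eq_iff)
  moreover have "E = H - {{a, c}, {b, d}} \<union> {{a, b}, {c, d}}"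
    using e n H by auto
  ultimately show ?thesis unfolding edge_switch_def by blast
qed

text \<open>Both edge sets arise from the same \<open>D\<close> by two insertions of new edges, so
  degrees and cardinalities can be compared one insertion at a time.\<close>

lemma edge_switch_common_edges:
  assumes "edge_switch E H"
  obtains a b c d D where "distinct [a, b, c, d]"
    "E = insert {a, b} (insert {c, d} D)" "{a, b} \<notin> insert {c, d} D" "{c, d} \<notin> D"
    "H = insert {a, c} (insert {b, d} D)" "{a, c} \<notin> insert {b, d} D" "{b, d} \<notin> D"
proof -
  obtain a b c d where d: "distinct [a, b, c, d]" and e: "{a, b} \<in> E" "{c, d} \<in> E"
    and n: "{a, c} \<notin> E" "{b, d} \<notin> E"
    and H: "H = E - {{a, b}, {c, d}} \<union> {{a, c}, {b, d}}"
    using assms unfolding edge_switch_def by blast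
  define D where "D = E - {{a, b}, {c, d}}"
  show ?thesis
  proof
    show "distinct [a, b, c, d]" by (rule d)
    show "E = insert {a, b} (insert {c, d} D)" using e by (auto simp: D_def)
    show "H = insert {a, c} (insert {b, d} D)" using H by (auto simp: D_def)
    show "{a, b} \<notin> insert {c, d} D" "{a, c} \<notin> insert {b, d} D"
      using d n by (auto simp: D_def doubleton_eq_iff)
    show "{c, d} \<notin> D" "{b, d} \<notin> D" using n by (auto simp: D_def)
  qed
qed

text \<open>Each of the four vertices loses one edge and gains one.\<close>

lemma edge_degree_switch:
  assumes "edge_switch E H" "finite E"
  shows "edge_degree H = edge_degree E"
proof
  fix v
  obtain a b c d D where D: "distinct [a, b, c, d]"
    "E = insert {a, b} (insert {c, d} D)" "{a, b} \<notin> insert {c, d} D" "{c, d} \<notin> D"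
    "H = insert {a, c} (insert {b, d} D)" "{a, c} \<notin> insert {b, d} D" "{b, d} \<notin> D"
    using edge_switch_common_edges[OF assms(1)] .
  have fin: "finite D" "finite (insert {c, d} D)" "finite (insert {b, d} D)"
    using assms(2) D(2) by simp_all
  show "edge_degree H v = edge_degree E v"
    unfolding D(2,5) edge_degree_insert[OF fin(2) D(3)] edge_degree_insert[OF fin(1) D(4)]
      edge_degree_insert[OF fin(3) D(6)] edge_degree_insert[OF fin(1) D(7)]
    using D(1) by auto
qed

lemma card_edge_switch:
  assumes "edge_switch E H" "finite E"
  shows "card H = card E"
proof -
  obtain a b c d D where
    "E = insert {a, b} (insert {c, d} D)" "{a, b} \<notin> insert {c, d} D" "{c, d} \<notin> D"
    "H = insert {a, c} (insert {b, d} D)" "{a, c} \<notin> insert {b, d} D" "{b, d} \<notin> D"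
    using edge_switch_common_edges[OF assms(1)] .
  then show ?thesis using assms(2) by simp
qed

text \<open>Both ends must be forests, so the reflexive transitive closure describes switch
  sequences that never leave the forests.\<close>

definition forest_switch :: "'a set set \<Rightarrow> 'a set set \<Rightarrow> bool" where
  "forest_switch E H \<longleftrightarrow> forest_edges E \<and> forest_edges H \<and> edge_switch E H"

lemma forest_switch_sym: "forest_switch E H \<Longrightarrow> forest_switch H E"
  unfolding forest_switch_def using edge_switch_sym by blast

lemma forest_switch_degree: "forest_switch E H \<Longrightarrow> edge_degree H = edge_degree E"
  unfolding forest_switch_def using edge_degree_switch forest_edges_def by blast

lemma forest_switch_insert_leaf:
  assumes "forest_switch E H" "edge_degree E v = 0" "v \<noteq> u"
  shows "forest_switch (insert {v, u} E) (insert {v, u} H)"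
proof -
  have f: "forest_edges E" "forest_edges H" using assms by (auto simp: forest_switch_def)
  have E0: "\<forall>e\<in>E. v \<notin> e"
    using f assms(2) by (simp add: forest_edges_def edge_degree_eq_0_iff)
  \<comment> \<open>A switch preserves degrees, so \<open>v\<close> is isolated in \<open>H\<close>
    as well and the added edge is pendant on both sides.\<close>
  have H0: "\<forall>e\<in>H. v \<notin> e"
    using f assms(2) forest_switch_degree[OF assms(1)]
    by (simp add: forest_edges_def flip: edge_degree_eq_0_iff)
  obtain a b c d where d: "distinct [a, b, c, d]" and e: "{a, b} \<in> E" "{c, d} \<in> E"
    and n: "{a, c} \<notin> E" "{b, d} \<notin> E"
    and H: "H = E - {{a, b}, {c, d}} \<union> {{a, c}, {b, d}}"
    using assms unfolding forest_switch_def edge_switch_def by blast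
  have v: "v \<notin> {a, b, c, d}" using E0 e by auto
  have "insert {v, u} H = insert {v, u} E - {{a, b}, {c, d}} \<union> {{a, c}, {b, d}}"
    using H v by (auto simp: doubleton_eq_iff)
  moreover have "{a, c} \<notin> insert {v, u} E" "{b, d} \<notin> insert {v, u} E"
    using n v by (auto simp: doubleton_eq_iff)
  ultimately have "edge_switch (insert {v, u} E) (insert {v, u} H)"
    unfolding edge_switch_def using d e by blast
  then show ?thesis
    unfolding forest_switch_def using f E0 H0 assms(3) forest_edges_insert_leaf by metis
qed

text \<open>The equality of degrees is carried through the induction because every later switch
  again needs \<open>v\<close> to be isolated.\<close>

lemma forest_switches_insert_leaf:
  assumes "forest_switch\<^sup>*\<^sup>* E H" "edge_degree E v = 0" "v \<noteq> u"
  shows "forest_switch\<^sup>*\<^sup>* (insert {v, u} E) (insert {v, u} H) \<and> edge_degree H = edge_degree E"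
  using assms(1)
proof (induction rule: rtranclp_induct)
  case base
  show ?case by simp
next
  case (step H K)
  then show ?case
    using forest_switch_insert_leaf[OF step.hyps(2), of v u] forest_switch_degree assms(2,3)
    by (metis rtranclp.rtrancl_into_rtrancl)
qed

text \<open>The switch replaces \<open>{v, u}\<close>, \<open>{c, w}\<close> by
  \<open>{v, c}\<close>, \<open>{u, w}\<close>. After the two deletions \<open>u\<close> and
  \<open>w\<close> are in different components, so \<open>{u, w}\<close> closes no cycle;
  \<open>v\<close> is then still isolated, so \<open>{v, c}\<close> can be added as a pendant
  edge.\<close>

lemma forest_switch_move_leaf:
  assumes E: "forest_edges E" and v: "edge_degree E v = 1" "{v, u} \<in> E"
    and w: "{c, w} \<in> E" "\<not> reach (E - {{v, u}, {c, w}}) u w" "{u, w} \<notin> E"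
    and neq: "c \<noteq> u" "c \<noteq> v" "w \<noteq> u"
  shows "\<exists>H. forest_switch E H \<and> {v, c} \<in> H"
proof -
  have nv: "e = {v, u}" if "e \<in> E" "v \<in> e" for e
    using edge_degree_1_unique[OF v that] .
  have uv: "u \<noteq> v" using E v(2) acyclic_edges_neq forest_edges_def by metis
  have wv: "w \<noteq> v" using nv[OF w(1)] neq by (auto simp: doubleton_eq_iff)
  define D where "D = E - {{v, u}, {c, w}}"
  define H where "H = insert {v, c} (insert {u, w} D)"
  have "forest_edges D" using E forest_edges_subset unfolding D_def by blast
  then have "forest_edges (insert {u, w} D)" using w(2) forest_edges_insert D_def by metis
  moreover have "\<forall>e\<in>insert {u, w} D. v \<notin> e"
    using nv uv wv by (auto simp: D_def)
  ultimately have "forest_edges H"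
    unfolding H_def using forest_edges_insert_leaf neq(2) by metis
  moreover have "edge_switch E H"
  proof -
    have "distinct [v, u, c, w]" using uv wv neq acyclic_edges_neq[OF _ w(1)] E
      by (auto simp: forest_edges_def)
    moreover have "{v, c} \<notin> E" using nv neq uv by (auto simp: doubleton_eq_iff)
    moreover have "H = E - {{v, u}, {c, w}} \<union> {{v, c}, {u, w}}"
      by (auto simp: H_def D_def)
    ultimately show ?thesis unfolding edge_switch_def using v(2) w(1,3) by blast
  qed
  ultimately show ?thesis unfolding forest_switch_def using E H_def by blast
qed

lemma forest_switch_move_leaf_to_branch:
  assumes E: "forest_edges E" and v: "edge_degree E v = 1" "{v, u} \<in> E"
    and c: "edge_degree E c > 1" "c \<noteq> u" "c \<noteq> v"
  shows "\<exists>H. forest_switch E H \<and> {v, c} \<in> H"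
proof -
  have ac: "acyclic_edges E" using E by (simp add: forest_edges_def)
  have "edge_degree E c > 0" using c(1) by simp
  then obtain w1 where w1: "{c, w1} \<in> E" using edge_degree_pos_neighbour[OF E] by blast
  then obtain w2 where w2: "{c, w2} \<in> E" "w2 \<noteq> w1"
    using edge_degree_not_1_neighbour[OF E] c(1) by (metis less_irrefl)
  \<comment> \<open>Of two neighbours of \<open>c\<close>, at least one is cut off from
    \<open>u\<close> when its edge to \<open>c\<close> is deleted.\<close>
  obtain w where w: "{c, w} \<in> E" "\<not> reach (E - {{c, w}}) u w"
    using acyclic_edges_neighbour_away[OF ac w1 w2(1)] w1 w2 by metis
  have "\<not> reach (E - {{v, u}, {c, w}}) u w"
    using w(2) reach_mono[of "E - {{v, u}, {c, w}}" u w "E - {{c, w}}"] by auto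
  moreover have "w \<noteq> u" using w(2) by auto
  \<comment> \<open>Such an edge differs from \<open>{c, w}\<close> and would itself connect
    \<open>u\<close> to \<open>w\<close> after the deletion.\<close>
  moreover have "{u, w} \<notin> E"
    using w(2) reach_edge[of u w "E - {{c, w}}"] c(2) \<open>w \<noteq> u\<close> by (auto simp: doubleton_eq_iff)
  ultimately show ?thesis using forest_switch_move_leaf[OF E v w(1)] c by blast
qed

text \<open>Here \<open>{v, u}\<close> is a whole component. Deleting it isolates \<open>u\<close>,
  so any neighbour \<open>w\<close> of \<open>c\<close> can be joined to \<open>u\<close> without
  closing a cycle.\<close>

lemma forest_switch_move_leaf_from_leaf:
  assumes E: "forest_edges E" and v: "edge_degree E v = 1" "{v, u} \<in> E"
    and u: "edge_degree E u = 1" and c: "edge_degree E c > 0" "c \<noteq> u" "c \<noteq> v"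
  shows "\<exists>H. forest_switch E H \<and> {v, c} \<in> H"
proof -
  have uv: "{u, v} \<in> E" using v(2) by (simp add: insert_commute)
  have nu: "e = {u, v}" if "e \<in> E" "u \<in> e" for e
    using edge_degree_1_unique[OF u uv that] .
  have nv: "e = {v, u}" if "e \<in> E" "v \<in> e" for e
    using edge_degree_1_unique[OF v that] .
  obtain w where w: "{c, w} \<in> E" using edge_degree_pos_neighbour[OF E c(1)] by blast
  have "w \<noteq> u" "w \<noteq> v" using nu[OF w] nv[OF w] c by (auto simp: doubleton_eq_iff)
  moreover from this have "{u, w} \<notin> E" using nu[of "{u, w}"] by (auto simp: doubleton_eq_iff)
  moreover have "\<not> reach (E - {{v, u}, {c, w}}) u w"
    using reach_isolated[of "E - {{v, u}, {c, w}}" u w] nu \<open>w \<noteq> u\<close>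
    by (auto simp: insert_commute)
  ultimately show ?thesis using forest_switch_move_leaf[OF E v w] c by blast
qed

lemma forest_switches_connect:
  assumes "forest_edges E" "forest_edges E'" "edge_degree E = edge_degree E'"
  shows "forest_switch\<^sup>*\<^sup>* E E'"
  using assms
proof (induction "card E" arbitrary: E E' rule: less_induct)
  case less
  \<comment> \<open>The induction step for two forests sharing a pendant edge. It is stated for
    arbitrary \<open>A\<close>, \<open>B\<close> since a preliminary switch may replace either
    \<open>E\<close> or \<open>E'\<close>.\<close>
  have common_leaf: "forest_switch\<^sup>*\<^sup>* A B"
    if A: "forest_edges A" "card A = card E" and B: "forest_edges B"
      and deg: "edge_degree A = edge_degree B"
      and v: "edge_degree A v = 1" "{v, u} \<in> A" "{v, u} \<in> B" for A B :: "'a set set" and v u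
  proof -
    define A' B' where "A' = A - {{v, u}}" and "B' = B - {{v, u}}"
    have eq: "A = insert {v, u} A'" "B = insert {v, u} B'" "{v, u} \<notin> A'" "{v, u} \<notin> B'"
      using v by (auto simp: A'_def B'_def)
    have f: "forest_edges A'" "forest_edges B'"
      using A(1) B forest_edges_subset unfolding A'_def B'_def by blast+
    then have fin: "finite A'" "finite B'" by (auto simp: forest_edges_def)
    have "edge_degree A' x = edge_degree B' x" for x
      using fun_cong[OF deg, of x] edge_degree_insert[OF fin(1) eq(3), of x]
        edge_degree_insert[OF fin(2) eq(4), of x] eq(1,2) by simp
    then have "edge_degree A' = edge_degree B'" by blast
    moreover have "card A' < card E" using fin(1) eq(1,3) A(2) by (metis card_insert_disjoint lessI)
    ultimately have "forest_switch\<^sup>*\<^sup>* A' B'" using less.hyps f by blast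
    moreover have "edge_degree A' v = 0"
      using v(1) edge_degree_insert[OF fin(1) eq(3), of v] eq(1) by simp
    moreover have "v \<noteq> u" using A(1) v(2) acyclic_edges_neq forest_edges_def by metis
    ultimately show ?thesis using forest_switches_insert_leaf eq(1,2) by metis
  qed
  show ?case
  proof (cases "E = {}")
    case True
    have "E' = {}"
    proof (rule ccontr)
      assume "E' \<noteq> {}"
      then obtain v where "edge_degree E' v = 1" using forest_edges_leaf less.prems(2) by blast
      then show False using True less.prems(3) by (simp add: edge_degree_def fun_eq_iff)
    qed
    then show ?thesis using True by simp
  next
    case False
    then obtain v where v: "edge_degree E v = 1" using forest_edges_leaf less.prems(1) by blast
    then have v': "edge_degree E' v = 1" using less.prems(3) by simp
    obtain u where u: "{v, u} \<in> E" using edge_degree_pos_neighbour[OF less.prems(1)]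
      v by (metis zero_less_one)
    obtain u' where u': "{v, u'} \<in> E'"
      using edge_degree_pos_neighbour[OF less.prems(2)] v' by (metis zero_less_one)
    have neq: "u \<noteq> v" "u' \<noteq> v"
      using u u' less.prems acyclic_edges_neq forest_edges_def by metis+
    have "edge_degree E u \<noteq> 0" "edge_degree E' u' \<noteq> 0"
      using u u' less.prems(1,2) edge_degree_eq_0_iff[of E u] edge_degree_eq_0_iff[of E' u']
      by (auto simp: forest_edges_def)
    then have pos: "edge_degree E' u > 0" "edge_degree E u' > 0" using less.prems(3) by simp_all
    \<comment> \<open>The degree of \<open>u'\<close> is positive and the same in both forests. Each
      alternative names the forest in which the preliminary switch is made.\<close>
    consider "u = u'" | "u \<noteq> u'" "edge_degree E u' > 1" | "u \<noteq> u'" "edge_degree E' u' = 1"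
      using pos less.prems(3) by fastforce
    then show ?thesis
    proof cases
      case 1
      then show ?thesis using common_leaf[OF less.prems(1) refl less.prems(2,3) v] u u' by blast
    next
      case 2
      then obtain H where H: "forest_switch E H" "{v, u'} \<in> H"
        using forest_switch_move_leaf_to_branch[OF less.prems(1) v u] neq by metis
      \<comment> \<open>The switched forest still has as many edges as \<open>E\<close>, so the
        induction hypothesis applies once the common pendant edge is removed.\<close>
      have "card H = card E"
        using H(1) card_edge_switch unfolding forest_switch_def forest_edges_def by metis
      then have "forest_switch\<^sup>*\<^sup>* H E'"
        using common_leaf[of H E' v u'] H u' v less.prems
          forest_switch_degree[OF H(1)] by (simp add: forest_switch_def)
      then show ?thesis using H(1) by (meson converse_rtranclp_into_rtranclp)
    next
      case 3
      then obtain H where H: "forest_switch E' H" "{v, u} \<in> H"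
        using forest_switch_move_leaf_from_leaf[OF less.prems(2) v' u'] neq pos by metis
      have "forest_switch\<^sup>*\<^sup>* E H"
        using common_leaf[of E H v u] H u v less.prems
          forest_switch_degree[OF H(1)] by (simp add: forest_switch_def)
      \<comment> \<open>The switch was made in \<open>E'\<close>; its inverse is the last step of
        the sequence from \<open>E\<close>.\<close>
      then show ?thesis using forest_switch_sym[OF H(1)] by (meson rtranclp.rtrancl_into_rtrancl)
    qed
  qed
qed

section \<open>Transfer to graphs\<close>

lemma rtranclp_successively:
  assumes "r\<^sup>*\<^sup>* x y"
  shows "\<exists>p. p \<noteq> [] \<and> hd p = x \<and> last p = y \<and> successively r p"
  using assms
proof (induction rule: rtranclp_induct)
  case base
  show ?case by (rule exI[of _ "[x]"]) simp
next
  case (step y z)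
  then obtain p where "p \<noteq> []" "hd p = x" "last p = y" "successively r p" by blast
  then show ?case using step.hyps(2)
    by (intro exI[of _ "p @ [z]"]) (simp add: successively_append_iff)
qed

lemma successively_rtranclp:
  "p \<noteq> [] \<Longrightarrow> successively r p \<Longrightarrow> r\<^sup>*\<^sup>* (hd p) (last p)"
proof (induction p rule: induct_list012)
  case (3 x y zs)
  then show ?case by (auto intro: converse_rtranclp_into_rtranclp)
qed auto

text \<open>When the next vertex already lies on the path, the path is cut off at that vertex
  instead of being extended.\<close>

lemma reach_distinct_path:
  assumes "reach E x y"
  shows "\<exists>p. p \<noteq> [] \<and> hd p = x \<and> last p = y \<and> distinct p \<and> successively (\<lambda>x y. {x, y} \<in> E) p"
  using assms[unfolded reach_def]
proof (induction rule: rtranclp_induct)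
  case base
  show ?case by (rule exI[of _ "[x]"]) simp
next
  case (step y z)
  then obtain p where p: "p \<noteq> []" "hd p = x" "last p = y" "distinct p"
    "successively (\<lambda>x y. {x, y} \<in> E) p" by blast
  show ?case
  proof (cases "z \<in> set p")
    case True
    then obtain q r where "p = q @ z # r" using split_list by metis
    then show ?thesis using p
      by (intro exI[of _ "q @ [z]"]) (auto simp: successively_append_iff hd_append split: if_splits)
  next
    case False
    then show ?thesis using p step.hyps(2)
      by (intro exI[of _ "p @ [z]"]) (simp add: successively_append_iff)
  qed
qed

lemma simple_graph_edgeD:
  "simple_graph G \<Longrightarrow> {x, y} \<in> edges G \<Longrightarrow> x \<in> verts G \<and> y \<in> verts G \<and> x \<noteq> y"
  unfolding simple_graph_def by (metis doubleton_eq_iff)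

lemma simple_graph_finite_edges:
  assumes "simple_graph G"
  shows "finite (edges G)"
proof (rule finite_subset)
  show "edges G \<subseteq> Pow (verts G)" using assms unfolding simple_graph_def by fastforce
  show "finite (Pow (verts G))" using assms by (simp add: simple_graph_def)
qed

text \<open>A cycle without its closing edge is a path joining the ends of that edge. Conversely, a
  simple path around an edge is closed to a cycle by it.\<close>

lemma forest_iff_acyclic_edges:
  "forest G \<longleftrightarrow> simple_graph G \<and> acyclic_edges (edges G)"
proof -
  have "(\<exists>p. is_cycle G p) \<longleftrightarrow> \<not> acyclic_edges (edges G)" if G: "simple_graph G"
  proof
    assume "\<exists>p. is_cycle G p"
    then obtain p where p: "successively (adjacent G) p" "length p \<ge> 3" "distinct p"
      and e: "{last p, hd p} \<in> edges G"
      unfolding is_cycle_def is_walk_def adjacent_def by blast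
    obtain x q where q: "p = x # q" using p(2) by (cases p) auto
    then obtain r y where r: "q = r @ [y]" using p(2) by (cases q rule: rev_cases) auto
    \<comment> \<open>An inner vertex separates \<open>x\<close> from \<open>y\<close>, so no step
      of the path is the closing edge.\<close>
    have "r \<noteq> []" using p(2) q r by auto
    let ?E = "edges G - {{x, y}}"
    have "successively (\<lambda>a b. {a, b} \<in> ?E) p"
    proof -
      have "successively (adjacent G) ((x # r) @ [y])" using p(1) q r by simp
      then have xr: "successively (adjacent G) (x # r)" and ry: "adjacent G (last r) y"
        using \<open>r \<noteq> []\<close> unfolding successively_append_iff by auto
      have y: "y \<notin> set (x # r)" and "x \<notin> set r" using p(3) q r by auto
      have 1: "successively (\<lambda>a b. {a, b} \<in> ?E) (x # r)"
        using xr by (rule successively_mono) (use y in \<open>auto simp: adjacent_def\<close>)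
      have "{last r, y} \<in> ?E"
        using ry y \<open>x \<notin> set r\<close> last_in_set[OF \<open>r \<noteq> []\<close>]
        by (auto simp: adjacent_def doubleton_eq_iff)
      then show ?thesis
        using 1 \<open>r \<noteq> []\<close> unfolding q r append_Cons[symmetric]
        by (simp only: successively_append_iff) simp
    qed
    then have "reach ?E x y"
      using successively_rtranclp[of p "\<lambda>a b. {a, b} \<in> ?E"] unfolding reach_def q r by simp
    then show "\<not> acyclic_edges (edges G)"
      using e q r by (auto simp: acyclic_edges_def insert_commute)
  next
    assume "\<not> acyclic_edges (edges G)"
    then obtain x y where xy: "{x, y} \<in> edges G" and r: "reach (edges G - {{x, y}}) x y"
      unfolding acyclic_edges_def by blast
    then obtain p where p: "p \<noteq> []" "hd p = x" "last p = y" "distinct p"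
      and s: "successively (\<lambda>a b. {a, b} \<in> edges G - {{x, y}}) p"
      using reach_distinct_path[OF r] by blast
    have "x \<noteq> y" "x \<in> verts G" using simple_graph_edgeD[OF G xy] by auto
    \<comment> \<open>One vertex would force \<open>x = y\<close>, and two would make the path use
      the deleted edge.\<close>
    have "length p \<ge> 3"
    proof (rule ccontr)
      assume "\<not> length p \<ge> 3"
      moreover have "length p \<noteq> 0" using p(1) by simp
      ultimately have "length p = 1 \<or> length p = 2" by linarith
      then show False using p s \<open>x \<noteq> y\<close> by (auto simp: length_Suc_conv numeral_2_eq_2)
    qed
    moreover have sG: "successively (adjacent G) p"
      using s by (rule successively_mono) (auto simp: adjacent_def)
    moreover have "set p \<subseteq> verts G"
    proof -
      have "hd p \<in> verts G \<Longrightarrow> successively (adjacent G) p \<Longrightarrow> set p \<subseteq> verts G" for p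
        by (induction p rule: induct_list012)
          (auto simp: adjacent_def dest: simple_graph_edgeD[OF G])
      then show ?thesis using sG p(2) \<open>x \<in> verts G\<close> by blast
    qed
    ultimately have "is_cycle G p"
      using p xy by (simp add: is_cycle_def is_walk_def adjacent_def insert_commute)
    then show "\<exists>p. is_cycle G p" by blast
  qed
  then show ?thesis unfolding forest_def by blast
qed

lemma forest_edges_of_forest:
  assumes "forest G"
  shows "forest_edges (edges G)"
proof -
  have "simple_graph G" "acyclic_edges (edges G)" using assms forest_iff_acyclic_edges by blast+
  then show ?thesis
    unfolding forest_edges_def using simple_graph_finite_edges
    by (metis simple_graph_def)
qed

section \<open>Switches of graphs and their degree sequences\<close>

lemma two_switch_iff_edge_switch:
  "two_switch G H \<longleftrightarrow> verts H = verts G \<and> edge_switch (edges G) (edges H)"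
  unfolding two_switch_def edge_switch_def prod_eq_iff fst_conv snd_conv
  by (intro iffI; elim exE conjE; intro conjI exI; assumption)

lemma simple_graph_two_switch:
  assumes G: "simple_graph G" and "two_switch G H"
  shows "simple_graph H"
proof -
  obtain a b c d where d: "distinct [a, b, c, d]" and e: "{a, b} \<in> edges G" "{c, d} \<in> edges G"
    and H: "H = (verts G, edges G - {{a, b}, {c, d}} \<union> {{a, c}, {b, d}})"
    using assms unfolding two_switch_def by blast
  have "a \<in> verts G" "b \<in> verts G" "c \<in> verts G" "d \<in> verts G"
    using simple_graph_edgeD[OF G] e by blast+
  then show ?thesis using G d unfolding H simple_graph_def by auto
qed

lemma degree_eq_edge_degree: "degree G = edge_degree (edges G)"
  by (simp add: fun_eq_iff degree_def edge_degree_def)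

lemma forest_switches_two_switches:
  assumes "forest_switch\<^sup>*\<^sup>* (edges F) E" "forest F"
  shows "(\<lambda>G H. two_switch G H \<and> forest G \<and> forest H)\<^sup>*\<^sup>* F (verts F, E) \<and> forest (verts F, E)"
  using assms(1)
proof (induction rule: rtranclp_induct)
  case base
  show ?case using assms(2) by simp
next
  case (step E H)
  then have sw: "two_switch (verts F, E) (verts F, H)" and H: "acyclic_edges H"
    by (auto simp: two_switch_iff_edge_switch forest_switch_def forest_edges_def)
  have "simple_graph (verts F, H)"
    using simple_graph_two_switch[OF _ sw] step.IH forest_def by blast
  then have "forest (verts F, H)" using H by (simp add: forest_iff_acyclic_edges)
  then show ?case using step.IH sw
    by (metis (no_types, lifting) rtranclp.rtrancl_into_rtrancl)
qed

text \<open>The lists compare degrees on \<open>{1..n}\<close> only. Outside this set no edge is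
  incident, so both degrees are 0 and the degree functions agree everywhere.\<close>

lemma edge_degree_graph_on:
  assumes "graph_on n F" "graph_on n F'" "degree_sequence F = degree_sequence F'"
  shows "edge_degree (edges F) = edge_degree (edges F')"
proof
  fix v
  have V: "verts F = {1..n}" "verts F' = {1..n}" and s: "simple_graph F" "simple_graph F'"
    using assms(1,2) by (auto simp: graph_on_def)
  show "edge_degree (edges F) v = edge_degree (edges F') v"
  proof (cases "v \<in> {1..n}")
    case True
    then have "v \<in> set [1..<Suc n]" by auto
    then show ?thesis using assms(3) V
      by (simp add: degree_sequence_def degree_eq_edge_degree del: upt_Suc)
  next
    case False
    have "v \<notin> e" if "simple_graph G" "verts G = {1..n}" "e \<in> edges G" for G e
      using that False unfolding simple_graph_def by fastforce
    then show ?thesis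
      using s V by (metis edge_degree_eq_0_iff simple_graph_finite_edges)
  qed
qed

lemma forests_two_switches:
  assumes "graph_on n F" "forest F" "graph_on n F'" "forest F'"
    "degree_sequence F = degree_sequence F'"
  shows "(\<lambda>G H. two_switch G H \<and> forest G \<and> forest H)\<^sup>*\<^sup>* F F'"
proof -
  have "forest_switch\<^sup>*\<^sup>* (edges F) (edges F')"
    using assms by (intro forest_switches_connect forest_edges_of_forest edge_degree_graph_on)
  note forest_switches_two_switches[OF this assms(2)]
  moreover have "(verts F, edges F') = F'"
    using assms(1,3) by (simp add: prod_eq_iff graph_on_def)
  ultimately show ?thesis by simp
qed

text \<open>The relation gives \<open>P\<close> for the target of each step, so the head needs its
  own assumption; this also settles lists of length one.\<close>

lemma successively_imp_all:
  assumes "p \<noteq> []" "P (hd p)" "successively r p" and step: "\<And>x y. r x y \<Longrightarrow> P y"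
  shows "\<forall>x\<in>set p. P x"
  using assms(1-3)
proof (induction p rule: induct_list012)
  case (3 x y zs)
  then show ?case using step[of x y] by simp
qed simp_all

section \<open>Connectedness of the graph of forest realizations\<close>

lemma two_switch_realizations:
  assumes "two_switch G H" "G \<in> realizations d"
  shows "H \<in> realizations d"
proof -
  have G: "simple_graph G" using assms(2) by (simp add: realizations_def graph_on_def)
  have "degree H = degree G"
    using assms(1) edge_degree_switch simple_graph_finite_edges[OF G]
    unfolding two_switch_iff_edge_switch degree_eq_edge_degree by blast
  moreover have "verts H = verts G" using assms(1) by (simp add: two_switch_iff_edge_switch)
  ultimately show ?thesis
    using assms(2) simple_graph_two_switch[OF G assms(1)]
    by (auto simp: realizations_def graph_on_def degree_sequence_def simp del: upt_Suc)
qed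

lemma connected_forest_realization_graph: "connected_graph (forest_realization_graph d)"
  unfolding connected_graph_def
proof (intro ballI)
  let ?G = "forest_realization_graph d"
  let ?r = "\<lambda>G H. two_switch G H \<and> forest G \<and> forest H"
  have V: "verts ?G = {F \<in> realizations d. forest F}"
    by (auto simp: forest_realization_graph_def induced_subgraph_def realization_graph_def)
  fix F F'
  assume F: "F \<in> verts ?G" and F': "F' \<in> verts ?G"
  have "?r\<^sup>*\<^sup>* F F'"
    by (rule forests_two_switches[of "length d"]) (use F F' V in \<open>auto simp: realizations_def\<close>)
  \<comment> \<open>Membership in \<open>realizations d\<close> is carried along, since the switch
    relation itself records only that its ends are forests.\<close>
  then have "(adjacent ?G)\<^sup>*\<^sup>* F F' \<and> F' \<in> realizations d"
  proof (induction rule: rtranclp_induct)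
    case base
    show ?case using F V by auto
  next
    case (step G H)
    then have "H \<in> realizations d" using two_switch_realizations by blast
    then have "{G, H} \<in> edges (realization_graph d)"
      using step.IH step.hyps(2) unfolding realization_graph_def snd_conv mem_Collect_eq by metis
    then have "adjacent ?G G H"
      using step \<open>H \<in> realizations d\<close>
      by (simp add: adjacent_def forest_realization_graph_def induced_subgraph_def)
    then show ?case using step.IH \<open>H \<in> realizations d\<close> by auto
  qed
  then obtain p where p: "p \<noteq> []" "hd p = F" "last p = F'" "successively (adjacent ?G) p"
    using rtranclp_successively by metis
  \<comment> \<open>Edges of the induced subgraph have both ends among the forest realizations, so
    the path found stays inside the vertex set.\<close>
  have "H \<in> verts ?G" if "adjacent ?G G H" for G H
    unfolding V using that
    by (simp add: adjacent_def forest_realization_graph_def induced_subgraph_def)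
  then have "\<forall>H\<in>set p. H \<in> verts ?G"
    using successively_imp_all[OF p(1) _ p(4), of "\<lambda>H. H \<in> verts ?G"] F p(2) by blast
  then show "\<exists>p. is_walk ?G p \<and> hd p = F \<and> last p = F'"
    using p by (auto simp: is_walk_def)
qed

theorem mainTheorem1:
  fixes d :: "nat list"
  assumes "is_degree_sequence d"
  shows "connected_graph (forest_realization_graph d) \<and>
    (\<forall>n F F'. graph_on n F \<and> forest F \<and> graph_on n F' \<and> forest F' \<and>
        degree_sequence F = degree_sequence F' \<longrightarrow>
      (\<exists>Fs. Fs \<noteq> [] \<and> hd Fs = F \<and> last Fs = F' \<and> successively two_switch Fs \<and>
        (\<forall>H\<in>set Fs. forest H)))"
proof (intro conjI allI impI)
  show "connected_graph (forest_realization_graph d)"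
    by (rule connected_forest_realization_graph)
next
  fix n F F'
  assume F: "graph_on n F \<and> forest F \<and> graph_on n F' \<and> forest F' \<and>
    degree_sequence F = degree_sequence F'"
  then have "(\<lambda>G H. two_switch G H \<and> forest G \<and> forest H)\<^sup>*\<^sup>* F F'"
    using forests_two_switches by blast
  then obtain p where p: "p \<noteq> []" "hd p = F" "last p = F'"
    "successively (\<lambda>G H. two_switch G H \<and> forest G \<and> forest H) p"
    using rtranclp_successively[of "\<lambda>G H. two_switch G H \<and> forest G \<and> forest H"] by blast
  have "\<forall>H\<in>set p. forest H"
    using successively_imp_all[OF p(1) _ p(4), of forest] F p(2) by blast
  moreover have "successively two_switch p"
    using p(4) by (rule successively_mono) auto
  ultimately show "\<exists>Fs. Fs \<noteq> [] \<and> hd Fs = F \<and> last Fs = F' \<and> successively two_switch Fs \<and>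
      (\<forall>H\<in>set Fs. forest H)"
    using p by blast
qed

end
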